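(* If a logic $\mathcal L=\langle\mathbf{Fm},\vdash_{\mathcal L}\rangle$ is a consistent extension of $\mathcal{LB}$, then ${\vdash_{\mathcal L}}={\models_{\mathcal{LB}}}$.
   Context: $\mathbf{Fm}$ is the algebra of formulas (with universe $Fm$) over a countable set of variables in the language $\{\land,\lor,\otimes,\oplus,\neg\}$ ($\land,\lor,\otimes,\oplus$ binary, $\neg$ unary, no constants). A logic is a pair $\langle\mathbf{Fm},\vdash\rangle$ where $\vdash$ is the consequence relation of a structural (substitution-invariant) closure operator on $Fm$ (not assumed finitary). A logic is consistent if there are $\varphi,\psi\in Fm$ with $\varphi\nvdash\psi$. $\mathcal L$ is an extension of $\mathcal{LB}$ if $\Gamma\models_{\mathcal{LB}}\varphi$ implies $\Gamma\vdash_{\mathcal L}\varphi$ for all $\Gamma\cup\{\varphi\}\subseteq Fm$. $\mathcal{FOUR}$ is the algebra with universe $\{\mathsf f,\bot,\top,\mathsf t\}$ where $\land,\lor$ are meet and join of the lattice order $\leq_t$ with $\mathsf f <_t \bot,\top <_t \mathsf t$ ($\bot,\top$ $\leq_t$-incomparable), $\otimes,\oplus$ are meet and join of the lattice order $\leq_k$ with $\bot <_k \mathsf f,\mathsf t <_k \top$ ($\mathsf f,\mathsf t$ $\leq_k$-incomparable), and $\neg \mathsf f = \mathsf t$, $\neg\mathsf t=\mathsf f$, $\neg\bot=\bot$, $\neg\top=\top$. Let $\mathsf{Tr}=\{\top,\mathsf t\}$. $\mathcal{LB}=\langle\mathbf{Fm},\models_{\mathcal{LB}}\rangle$ is the logic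 given by: $\Gamma\models_{\mathcal{LB}}\varphi$ iff for every homomorphism $h:\mathbf{Fm}\to\mathcal{FOUR}$, $h[\Gamma]\subseteq \mathsf{Tr}$ implies $h(\varphi)\in\mathsf{Tr}$. *)

theory Defs
  imports Main "HOL-Library.Countable"
begin

record 'a bialgebra =
  conj_op :: "'a \<Rightarrow> 'a \<Rightarrow> 'a"
  disj_op :: "'a \<Rightarrow> 'a \<Rightarrow> 'a"
  otimes_op :: "'a \<Rightarrow> 'a \<Rightarrow> 'a"
  oplus_op :: "'a \<Rightarrow> 'a \<Rightarrow> 'a"
  neg_op :: "'a \<Rightarrow> 'a"

text \<open>The universe of an algebra is its whole carrier type, so homomorphisms are
  unrestricted functions.\<close>

definition homomorphism :: "'a bialgebra \<Rightarrow> 'b bialgebra \<Rightarrow> ('a \<Rightarrow> 'b) \<Rightarrow> bool" where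
  "homomorphism A B h \<longleftrightarrow>
     (\<forall>x y. h (conj_op A x y) = conj_op B (h x) (h y)) \<and>
     (\<forall>x y. h (disj_op A x y) = disj_op B (h x) (h y)) \<and>
     (\<forall>x y. h (otimes_op A x y) = otimes_op B (h x) (h y)) \<and>
     (\<forall>x y. h (oplus_op A x y) = oplus_op B (h x) (h y)) \<and>
     (\<forall>x. h (neg_op A x) = neg_op B (h x))"

datatype 'v fm =
    Var 'v
  | Conj "'v fm" "'v fm"
  | Disj "'v fm" "'v fm"
  | Otimes "'v fm" "'v fm"
  | Oplus "'v fm" "'v fm"
  | Neg "'v fm"

definition Fm :: "'v fm bialgebra" where
  "Fm = \<lparr>conj_op = Conj, disj_op = Disj, otimes_op = Otimes, oplus_op = Oplus, neg_op = Neg\<rparr>"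

datatype four = Ff | Bot | Top | Tt

definition le_t :: "four \<Rightarrow> four \<Rightarrow> bool" where
  "le_t x y \<longleftrightarrow> x = y \<or> x = Ff \<or> y = Tt"

definition le_k :: "four \<Rightarrow> four \<Rightarrow> bool" where
  "le_k x y \<longleftrightarrow> x = y \<or> x = Bot \<or> y = Top"

text \<open>Two incomparable elements have the least element as meet and the greatest as join;
  \<open>lattice_t\<close> and \<open>lattice_k\<close> below confirm that these are the lattice operations.\<close>

definition meet_t :: "four \<Rightarrow> four \<Rightarrow> four" where
  "meet_t x y = (if le_t x y then x else if le_t y x then y else Ff)"

definition join_t :: "four \<Rightarrow> four \<Rightarrow> four" where
  "join_t x y = (if le_t x y then y else if le_t y x then x else Tt)"

definition meet_k :: "four \<Rightarrow> four \<Rightarrow> four" where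
  "meet_k x y = (if le_k x y then x else if le_k y x then y else Bot)"

definition join_k :: "four \<Rightarrow> four \<Rightarrow> four" where
  "join_k x y = (if le_k x y then y else if le_k y x then x else Top)"

primrec neg4 :: "four \<Rightarrow> four" where
  "neg4 Ff = Tt"
| "neg4 Bot = Bot"
| "neg4 Top = Top"
| "neg4 Tt = Ff"

lemma lattice_t: "class.lattice meet_t le_t (\<lambda>x y. le_t x y \<and> x \<noteq> y) join_t"
  by unfold_locales (auto simp: le_t_def meet_t_def join_t_def split: if_splits intro: four.exhaust)

lemma lattice_k: "class.lattice meet_k le_k (\<lambda>x y. le_k x y \<and> x \<noteq> y) join_k"
  by unfold_locales (auto simp: le_k_def meet_k_def join_k_def split: if_splits intro: four.exhaust)

definition FOUR :: "four bialgebra" where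
  "FOUR = \<lparr>conj_op = meet_t, disj_op = join_t, otimes_op = meet_k, oplus_op = join_k, neg_op = neg4\<rparr>"

definition Tr :: "four set" where
  "Tr = {Top, Tt}"

definition LB :: "'v fm set \<Rightarrow> 'v fm \<Rightarrow> bool" where
  "LB \<Gamma> \<phi> \<longleftrightarrow> (\<forall>h. homomorphism Fm FOUR h \<longrightarrow> h ` \<Gamma> \<subseteq> Tr \<longrightarrow> h \<phi> \<in> Tr)"

definition closure_operator :: "('a set \<Rightarrow> 'a set) \<Rightarrow> bool" where
  "closure_operator C \<longleftrightarrow>
     (\<forall>X. X \<subseteq> C X) \<and> (\<forall>X Y. X \<subseteq> Y \<longrightarrow> C X \<subseteq> C Y) \<and> (\<forall>X. C (C X) = C X)"

text \<open>Substitutions are the endomorphisms of the formula algebra.\<close>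

definition structural :: "('v fm set \<Rightarrow> 'v fm set) \<Rightarrow> bool" where
  "structural C \<longleftrightarrow> (\<forall>\<sigma> \<Gamma>. homomorphism Fm Fm \<sigma> \<longrightarrow> \<sigma> ` C \<Gamma> \<subseteq> C (\<sigma> ` \<Gamma>))"

definition is_logic :: "('v fm set \<Rightarrow> 'v fm \<Rightarrow> bool) \<Rightarrow> bool" where
  "is_logic L \<longleftrightarrow>
     (\<exists>C. closure_operator C \<and> structural C \<and> (\<forall>\<Gamma> \<phi>. L \<Gamma> \<phi> \<longleftrightarrow> \<phi> \<in> C \<Gamma>))"

definition consistent :: "('v fm set \<Rightarrow> 'v fm \<Rightarrow> bool) \<Rightarrow> bool" where
  "consistent L \<longleftrightarrow> (\<exists>\<phi> \<psi>. \<not> L {\<phi>} \<psi>)"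

definition extension_of :: "('v fm set \<Rightarrow> 'v fm \<Rightarrow> bool) \<Rightarrow> ('v fm set \<Rightarrow> 'v fm \<Rightarrow> bool) \<Rightarrow> bool" where
  "extension_of L L' \<longleftrightarrow> (\<forall>\<Gamma> \<phi>. L' \<Gamma> \<phi> \<longrightarrow> L \<Gamma> \<phi>)"

end

theory Submission
  imports Defs
begin

text \<open>Suppose \<open>\<Gamma> \<turnstile> \<phi>\<close> holds in an extension of \<open>LB\<close> but is refuted in \<open>FOUR\<close> by \<open>h\<close>. For a formula
  \<open>\<chi>\<close> with variables \<open>p\<^sub>1, \<dots>, p\<^sub>n\<close>, the meet and the join, in the knowledge order, of all \<open>p\<^sub>i\<close> and
  \<open>\<not> p\<^sub>i\<close> take the values \<open>Bot\<close> and \<open>Top\<close>, except that both are \<open>Top\<close> when all \<open>p\<^sub>i\<close> are \<open>Top\<close> and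
  both are \<open>Bot\<close> when all \<open>p\<^sub>i\<close> are \<open>Bot\<close>; their truth-order join and meet then give \<open>Tt\<close> and \<open>Ff\<close>.
  Let \<open>\<sigma>\<close> send each variable \<open>v\<close> to the formula that so represents \<open>h v\<close>. A valuation composed
  with \<open>\<sigma>\<close> is then \<open>h\<close>, constantly \<open>Top\<close>, or constantly \<open>Bot\<close>. Hence \<open>\<alpha>\<close> entails \<open>\<sigma> \<gamma>\<close> for every
  \<open>\<gamma> \<in> \<Gamma>\<close>, and \<open>\<sigma> \<phi>\<close> entails \<open>\<beta>\<close>, whenever the variables of \<open>\<alpha>\<close> and \<open>\<beta>\<close> are among the \<open>p\<^sub>i\<close>.
  So \<open>\<alpha> \<turnstile> \<beta>\<close> for all \<open>\<alpha>\<close> and \<open>\<beta>\<close>.\<close>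

primrec eval_fm :: "'a bialgebra \<Rightarrow> ('v \<Rightarrow> 'a) \<Rightarrow> 'v fm \<Rightarrow> 'a" where
  "eval_fm A e (Var v) = e v"
| "eval_fm A e (Conj x y) = conj_op A (eval_fm A e x) (eval_fm A e y)"
| "eval_fm A e (Disj x y) = disj_op A (eval_fm A e x) (eval_fm A e y)"
| "eval_fm A e (Otimes x y) = otimes_op A (eval_fm A e x) (eval_fm A e y)"
| "eval_fm A e (Oplus x y) = oplus_op A (eval_fm A e x) (eval_fm A e y)"
| "eval_fm A e (Neg x) = neg_op A (eval_fm A e x)"

lemma homomorphism_eval_fm: "homomorphism Fm A (eval_fm A e)"
  by (simp add: homomorphism_def Fm_def)

lemma homomorphism_comp:
  "homomorphism A B f \<Longrightarrow> homomorphism B C g \<Longrightarrow> homomorphism A C (g \<circ> f)"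
  by (simp add: homomorphism_def)

lemma homomorphism_Fm_FOUR:
  assumes "homomorphism Fm FOUR h"
  shows "h (Conj x y) = meet_t (h x) (h y)" "h (Disj x y) = join_t (h x) (h y)"
    "h (Otimes x y) = meet_k (h x) (h y)" "h (Oplus x y) = join_k (h x) (h y)"
    "h (Neg x) = neg4 (h x)"
  using assms by (simp_all add: homomorphism_def Fm_def FOUR_def)

lemma homomorphism_Fm_FOUR_eqI:
  assumes "homomorphism Fm FOUR g" "homomorphism Fm FOUR h" "\<And>v. g (Var v) = h (Var v)"
  shows "g x = h x"
  by (induction x)
    (simp_all add: assms(3) homomorphism_Fm_FOUR[OF assms(1)] homomorphism_Fm_FOUR[OF assms(2)])

text \<open>\<open>{Top}\<close> and \<open>{Bot}\<close> are subalgebras of \<open>FOUR\<close>: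
  both values are fixed by negation and idempotent under the lattice operations.\<close>

lemma homomorphism_const:
  assumes "homomorphism Fm FOUR h" "c = Top \<or> c = Bot" "\<And>v. v \<in> set_fm x \<Longrightarrow> h (Var v) = c"
  shows "h x = c"
  using assms(2,3)
  by (induction x)
    (auto simp: homomorphism_Fm_FOUR[OF assms(1)] meet_t_def join_t_def meet_k_def join_k_def
      le_t_def le_k_def)

text \<open>The language has no constants. This keeps the all-\<open>Top\<close> and
  all-\<open>Bot\<close> cases below from holding at once.\<close>

lemma set_fm_nonempty: "set_fm x \<noteq> {}"
  by (induction x) auto

primrec bot_fm :: "'v fm \<Rightarrow> 'v fm" where
  "bot_fm (Var v) = Otimes (Var v) (Neg (Var v))"
| "bot_fm (Conj x y) = Otimes (bot_fm x) (bot_fm y)"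
| "bot_fm (Disj x y) = Otimes (bot_fm x) (bot_fm y)"
| "bot_fm (Otimes x y) = Otimes (bot_fm x) (bot_fm y)"
| "bot_fm (Oplus x y) = Otimes (bot_fm x) (bot_fm y)"
| "bot_fm (Neg x) = bot_fm x"

primrec top_fm :: "'v fm \<Rightarrow> 'v fm" where
  "top_fm (Var v) = Oplus (Var v) (Neg (Var v))"
| "top_fm (Conj x y) = Oplus (top_fm x) (top_fm y)"
| "top_fm (Disj x y) = Oplus (top_fm x) (top_fm y)"
| "top_fm (Otimes x y) = Oplus (top_fm x) (top_fm y)"
| "top_fm (Oplus x y) = Oplus (top_fm x) (top_fm y)"
| "top_fm (Neg x) = top_fm x"

text \<open>A variable and its negation meet in \<open>Top\<close> if the variable is
  \<open>Top\<close>, else in \<open>Bot\<close>; one \<open>Bot\<close> pulls the whole meet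
  down.\<close>

lemma bot_fm_value:
  assumes "homomorphism Fm FOUR h"
  shows "h (bot_fm x) = (if \<forall>v\<in>set_fm x. h (Var v) = Top then Top else Bot)"
proof (induction x)
  case (Var v)
  then show ?case
    by (cases "h (Var v)") (simp_all add: homomorphism_Fm_FOUR[OF assms] meet_k_def le_k_def)
qed (auto simp: homomorphism_Fm_FOUR[OF assms] meet_k_def le_k_def)

lemma top_fm_value:
  assumes "homomorphism Fm FOUR h"
  shows "h (top_fm x) = (if \<forall>v\<in>set_fm x. h (Var v) = Bot then Bot else Top)"
proof (induction x)
  case (Var v)
  then show ?case
    by (cases "h (Var v)") (simp_all add: homomorphism_Fm_FOUR[OF assms] join_k_def le_k_def)
qed (auto simp: homomorphism_Fm_FOUR[OF assms] join_k_def le_k_def)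

primrec value_fm :: "'v fm \<Rightarrow> four \<Rightarrow> 'v fm" where
  "value_fm x Bot = bot_fm x"
| "value_fm x Top = top_fm x"
| "value_fm x Tt = Disj (bot_fm x) (top_fm x)"
| "value_fm x Ff = Conj (bot_fm x) (top_fm x)"

lemma value_fm_cases:
  assumes g: "homomorphism Fm FOUR g"
  obtains (top) "\<And>v. v \<in> set_fm x \<Longrightarrow> g (Var v) = Top" "\<And>c. g (value_fm x c) = Top"
  | (bot) "\<And>v. v \<in> set_fm x \<Longrightarrow> g (Var v) = Bot" "\<And>c. g (value_fm x c) = Bot"
  | (id) "\<And>c. g (value_fm x c) = c"
proof -
  note ops = homomorphism_Fm_FOUR[OF g] bot_fm_value[OF g] top_fm_value[OF g]
    meet_t_def join_t_def le_t_def
  obtain w where w: "w \<in> set_fm x" using set_fm_nonempty[of x] by blast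
  consider "\<forall>v\<in>set_fm x. g (Var v) = Top" | "\<forall>v\<in>set_fm x. g (Var v) = Bot"
    | "\<not> (\<forall>v\<in>set_fm x. g (Var v) = Top)" "\<not> (\<forall>v\<in>set_fm x. g (Var v) = Bot)" by blast
  then show thesis
  proof cases
    case 1
    then have "\<not> (\<forall>v\<in>set_fm x. g (Var v) = Bot)" using w by force
    then have "g (value_fm x c) = Top" for c using 1 by (cases c) (simp_all add: ops)
    then show thesis using 1 top by blast
  next
    case 2
    then have "\<not> (\<forall>v\<in>set_fm x. g (Var v) = Top)" using w by force
    then have "g (value_fm x c) = Bot" for c using 2 by (cases c) (simp_all add: ops)
    then show thesis using 2 bot by blast
  next
    case 3
    \<comment> \<open>The negated quantifiers must keep their form to decide the conditionals in
      \<open>ops\<close>.\<close>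
    then have "g (value_fm x c) = c" for c by (cases c) (simp_all add: ops del: ball_simps)
    then show thesis by (rule id)
  qed
qed

text \<open>Homomorphisms are determined on variables, so the trichotomy for single values lifts to
  the composite of \<open>g\<close> with \<open>\<sigma>\<close>.\<close>

lemma eval_value_fm_cases:
  fixes x :: "'v fm" and h :: "'w fm \<Rightarrow> four"
  assumes g: "homomorphism Fm FOUR g" and h: "homomorphism Fm FOUR h"
  defines "\<sigma> \<equiv> eval_fm Fm (\<lambda>v. value_fm x (h (Var v)))"
  obtains (top) "\<And>v. v \<in> set_fm x \<Longrightarrow> g (Var v) = Top" "\<And>y. g (\<sigma> y) = Top"
  | (bot) "\<And>v. v \<in> set_fm x \<Longrightarrow> g (Var v) = Bot" "\<And>y. g (\<sigma> y) = Bot"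
  | (id) "\<And>y. g (\<sigma> y) = h y"
proof -
  have \<sigma>: "\<sigma> (Var v) = value_fm x (h (Var v))" for v by (simp add: \<sigma>_def)
  have g\<sigma>: "homomorphism Fm FOUR (g \<circ> \<sigma>)"
    unfolding \<sigma>_def by (intro homomorphism_comp[OF homomorphism_eval_fm g])
  from g show thesis
  proof (cases rule: value_fm_cases[where x = x])
    case top
    then show thesis using that(1) homomorphism_const[OF g\<sigma>] by (simp add: \<sigma>)
  next
    case bot
    then show thesis using that(2) homomorphism_const[OF g\<sigma>] by (simp add: \<sigma>)
  next
    case id
    then show thesis using that(3) homomorphism_Fm_FOUR_eqI[OF g\<sigma> h] by (simp add: \<sigma>)
  qed
qed

lemma LB_refuted_substitution:
  fixes \<alpha> \<beta> :: "'v fm"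
  assumes "\<not> LB \<Gamma> \<phi>"
  obtains \<sigma> :: "'v fm \<Rightarrow> 'v fm" where "homomorphism Fm Fm \<sigma>"
    and "\<And>\<gamma>. \<gamma> \<in> \<Gamma> \<Longrightarrow> LB {\<alpha>} (\<sigma> \<gamma>)" and "LB {\<sigma> \<phi>} \<beta>"
proof -
  obtain h where h: "homomorphism Fm FOUR h" "h ` \<Gamma> \<subseteq> Tr" "h \<phi> \<notin> Tr"
    using assms unfolding LB_def by blast
  \<comment> \<open>\<open>Conj\<close> only pools the variables of \<open>\<alpha>\<close> and
    \<open>\<beta>\<close>.\<close>
  define \<sigma> where "\<sigma> = eval_fm Fm (\<lambda>v. value_fm (Conj \<alpha> \<beta>) (h (Var v)))"
  show thesis
  proof
    show "homomorphism Fm Fm \<sigma>" unfolding \<sigma>_def by (rule homomorphism_eval_fm)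
  next
    fix \<gamma> assume "\<gamma> \<in> \<Gamma>"
    show "LB {\<alpha>} (\<sigma> \<gamma>)"
      unfolding LB_def
    proof (intro allI impI)
      fix g assume g: "homomorphism Fm FOUR g" and "g ` {\<alpha>} \<subseteq> Tr"
      \<comment> \<open>This excludes the all-\<open>Bot\<close> case, where \<open>\<alpha>\<close>
        would itself be \<open>Bot\<close>.\<close>
      then have \<alpha>: "g \<alpha> \<noteq> Bot" by (auto simp: Tr_def)
      from g h(1) show "g (\<sigma> \<gamma>) \<in> Tr"
      proof (cases rule: eval_value_fm_cases[where x = "Conj \<alpha> \<beta>"])
        case top
        then show ?thesis by (simp add: Tr_def \<sigma>_def)
      next
        case bot
        then show ?thesis using \<alpha> homomorphism_const[OF g, of Bot \<alpha>] by simp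
      next
        case id
        then show ?thesis using h(2) \<open>\<gamma> \<in> \<Gamma>\<close> by (auto simp: \<sigma>_def)
      qed
    qed
  next
    show "LB {\<sigma> \<phi>} \<beta>"
      unfolding LB_def
    proof (intro allI impI)
      fix g assume g: "homomorphism Fm FOUR g" and \<phi>: "g ` {\<sigma> \<phi>} \<subseteq> Tr"
      from g h(1) show "g \<beta> \<in> Tr"
      proof (cases rule: eval_value_fm_cases[where x = "Conj \<alpha> \<beta>"])
        case top
        then show ?thesis using homomorphism_const[OF g, of Top \<beta>] by (simp add: Tr_def)
      next
        case bot
        then show ?thesis using \<phi> by (simp add: Tr_def \<sigma>_def)
      next
        case id
        then show ?thesis using \<phi> h(3) by (simp add: \<sigma>_def)
      qed
    qed
  qed
qed

text \<open>Cut for arbitrary, possibly infinite sets, by monotonicity and idempotence of the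
  closure operator.\<close>

lemma is_logic_cut:
  assumes "is_logic L" "\<And>\<gamma>. \<gamma> \<in> \<Gamma> \<Longrightarrow> L \<Delta> \<gamma>" "L \<Gamma> \<phi>"
  shows "L \<Delta> \<phi>"
proof -
  obtain C where C: "closure_operator C" "\<And>\<Gamma> \<phi>. L \<Gamma> \<phi> \<longleftrightarrow> \<phi> \<in> C \<Gamma>"
    using assms(1) unfolding is_logic_def by blast
  have "\<Gamma> \<subseteq> C \<Delta>" using assms(2) C(2) by blast
  then have "C \<Gamma> \<subseteq> C \<Delta>" using C(1) unfolding closure_operator_def by metis
  then show ?thesis using assms(3) C(2) by blast
qed

lemma is_logic_substitution:
  "is_logic L \<Longrightarrow> homomorphism Fm Fm \<sigma> \<Longrightarrow> L \<Gamma> \<phi> \<Longrightarrow> L (\<sigma> ` \<Gamma>) (\<sigma> \<phi>)"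
  unfolding is_logic_def structural_def by blast

theorem proposition3p3p2:
  fixes L :: "'v::countable fm set \<Rightarrow> 'v fm \<Rightarrow> bool"
  assumes "is_logic L"
    and "consistent L"
    and "extension_of L LB"
  shows "L = LB"
proof (intro ext iffI)
  fix \<Gamma> :: "'v fm set" and \<phi>
  assume L: "L \<Gamma> \<phi>"
  have ext: "L \<Delta> \<psi>" if "LB \<Delta> \<psi>" for \<Delta> \<psi>
    using assms(3) that unfolding extension_of_def by blast
  show "LB \<Gamma> \<phi>"
  proof (rule ccontr)
    assume refuted: "\<not> LB \<Gamma> \<phi>"
    have "L {\<alpha>} \<beta>" for \<alpha> \<beta>
    proof -
      obtain \<sigma> where \<sigma>: "homomorphism Fm Fm \<sigma>" "\<And>\<gamma>. \<gamma> \<in> \<Gamma> \<Longrightarrow> LB {\<alpha>} (\<sigma> \<gamma>)" "LB {\<sigma> \<phi>} \<beta>"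
        using LB_refuted_substitution[OF refuted] by blast
      have "L (\<sigma> ` \<Gamma>) (\<sigma> \<phi>)" using assms(1) \<sigma>(1) L by (rule is_logic_substitution)
      then have "L {\<alpha>} (\<sigma> \<phi>)" using is_logic_cut[OF assms(1), of "\<sigma> ` \<Gamma>" "{\<alpha>}"] \<sigma>(2) ext by blast
      then show ?thesis using is_logic_cut[OF assms(1), of "{\<sigma> \<phi>}" "{\<alpha>}"] \<sigma>(3) ext by blast
    qed
    then show False using assms(2) unfolding consistent_def by blast
  qed
next
  fix \<Gamma> :: "'v fm set" and \<phi>
  assume "LB \<Gamma> \<phi>"
  then show "L \<Gamma> \<phi>" using assms(3) unfolding extension_of_def by blast
qed

end
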